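(* Let $n\ge 2$. Among all trees $T$ of order $n$ and all vertices $r\in V(T)$, the maximum value of $CC(r)$ is $\frac{n^3-n}{3} - \left\lfloor \frac{n^2}{4} \right\rfloor$, and it is attained when $T$ is a path and $r$ is a midpoint of it.
   Context: The simple random walk moves at each step to a uniformly random neighbour; $H_{vw}$ is the expected number of steps for the walk started at $v$ to first reach $w$ ($H_{vv}=0$). The cover cost is $CC(r)=\sum_{w\in V(T)} H_{rw}$. A midpoint of a path is a vertex minimizing the sum of distances to all other vertices. *)

theory Defs
  imports "HOL-Probability.Probability"
begin

definition simple_graph :: "'a set \<Rightarrow> 'a set set \<Rightarrow> bool" where
  "simple_graph V E \<longleftrightarrow> finite V \<and> (\<forall>e\<in>E. e \<subseteq> V \<and> card e = 2)"

definition neighbours :: "'a set set \<Rightarrow> 'a \<Rightarrow> 'a set" where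
  "neighbours E v = {u. {v, u} \<in> E}"

definition graph_walk :: "'a set \<Rightarrow> 'a set set \<Rightarrow> 'a list \<Rightarrow> bool" where
  "graph_walk V E xs \<longleftrightarrow>
     xs \<noteq> [] \<and> set xs \<subseteq> V \<and> successively (\<lambda>u v. {u, v} \<in> E) xs"

definition connected_graph :: "'a set \<Rightarrow> 'a set set \<Rightarrow> bool" where
  "connected_graph V E \<longleftrightarrow>
     V \<noteq> {} \<and> (\<forall>u\<in>V. \<forall>v\<in>V. \<exists>xs. graph_walk V E xs \<and> hd xs = u \<and> last xs = v)"

definition graph_cycle :: "'a set \<Rightarrow> 'a set set \<Rightarrow> 'a list \<Rightarrow> bool" where
  "graph_cycle V E xs \<longleftrightarrow>
     graph_walk V E xs \<and> distinct xs \<and> 3 \<le> length xs \<and> {last xs, hd xs} \<in> E"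

definition tree_graph :: "'a set \<Rightarrow> 'a set set \<Rightarrow> bool" where
  "tree_graph V E \<longleftrightarrow>
     simple_graph V E \<and> connected_graph V E \<and> (\<nexists>xs. graph_cycle V E xs)"

definition path_graph :: "'a set \<Rightarrow> 'a set set \<Rightarrow> bool" where
  "path_graph V E \<longleftrightarrow>
     (\<exists>xs. xs \<noteq> [] \<and> distinct xs \<and> V = set xs \<and>
           E = {{xs ! i, xs ! Suc i} | i. Suc i < length xs})"

definition graph_dist :: "'a set \<Rightarrow> 'a set set \<Rightarrow> 'a \<Rightarrow> 'a \<Rightarrow> nat" where
  "graph_dist V E u v =
     (LEAST k. \<exists>xs. graph_walk V E xs \<and> hd xs = u \<and> last xs = v \<and> length xs = Suc k)"

definition midpoint_of :: "'a set \<Rightarrow> 'a set set \<Rightarrow> 'a \<Rightarrow> bool" where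
  "midpoint_of V E r \<longleftrightarrow>
     r \<in> V \<and> (\<forall>v\<in>V. (\<Sum>w\<in>V. graph_dist V E r w) \<le> (\<Sum>w\<in>V. graph_dist V E v w))"

text \<open>
  The simple random walk is realised by an i.i.d. sequence of uniformly random elements of
  \<open>\<Pi>\<^sub>E u\<in>V. neighbours E u\<close>, i.e. maps sending every vertex \<open>u\<close> to a uniformly random neighbour of
  \<open>u\<close>, independently over \<open>u\<close>; the walk applies the \<open>k\<close>-th map to its position after \<open>k\<close> steps.
  The lemma \<open>srw_cylinder\<close> below confirms that, in the absence of isolated vertices, this has the
  law of the simple random walk.
\<close>

definition srw_space :: "'a set \<Rightarrow> 'a set set \<Rightarrow> ('a \<Rightarrow> 'a) stream measure" where
  "srw_space V E = stream_space (uniform_count_measure (\<Pi>\<^sub>E u\<in>V. neighbours E u))"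

primrec srw :: "'a \<Rightarrow> ('a \<Rightarrow> 'a) stream \<Rightarrow> nat \<Rightarrow> 'a" where
  "srw v \<omega> 0 = v"
| "srw v \<omega> (Suc k) = (\<omega> !! k) (srw v \<omega> k)"

text \<open>The infimum over the empty set is \<open>\<infinity>\<close>, for a walk that never reaches \<open>w\<close>.\<close>

definition first_hit :: "'a \<Rightarrow> (nat \<Rightarrow> 'a) \<Rightarrow> ennreal" where
  "first_hit w X = (INF k\<in>{k. X k = w}. of_nat k)"

definition hitting_time :: "'a set \<Rightarrow> 'a set set \<Rightarrow> 'a \<Rightarrow> 'a \<Rightarrow> ennreal" where
  "hitting_time V E v w = (\<integral>\<^sup>+\<omega>. first_hit w (srw v \<omega>) \<partial>srw_space V E)"

definition cover_cost :: "'a set \<Rightarrow> 'a set set \<Rightarrow> 'a \<Rightarrow> ennreal" where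
  "cover_cost V E r = (\<Sum>w\<in>V. hitting_time V E r w)"

lemma srw_Suc_shift: "srw v \<omega> (Suc k) = srw (shd \<omega> v) (stl \<omega>) k"
  by (induction k) auto

lemma measurable_srw:
  assumes "finite V" and "\<And>u. u \<in> V \<Longrightarrow> finite (neighbours E u)"
  shows "(\<lambda>\<omega>. srw v \<omega> k) \<in> measurable (srw_space V E) (count_space UNIV)"
proof (induction k arbitrary: v)
  case (Suc k)
  define F where "F = (\<Pi>\<^sub>E u\<in>V. neighbours E u)"
  have "countable F"
    using assms by (auto simp: F_def intro!: countable_finite finite_PiE)
  have S: "srw_space V E = stream_space (uniform_count_measure F)"
    by (simp add: srw_space_def F_def)
  have "shd \<in> measurable (srw_space V E) (uniform_count_measure F)"
    unfolding S by (rule measurable_shd)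
  also have "measurable (srw_space V E) (uniform_count_measure F) =
      measurable (srw_space V E) (count_space F)"
    by (rule measurable_cong_sets) (simp_all add: sets_uniform_count_measure)
  finally have "shd \<in> measurable (srw_space V E) (count_space F)" .
  moreover have "(\<lambda>\<omega>. srw u (stl \<omega>) k) \<in> measurable (srw_space V E) (count_space UNIV)" for u
    using measurable_compose[OF measurable_stl Suc[of u, unfolded S]] unfolding S .
  ultimately have "(\<lambda>\<omega>. srw (shd \<omega> v) (stl \<omega>) k) \<in> measurable (srw_space V E) (count_space UNIV)"
    using \<open>countable F\<close>
      measurable_compose_countable'[of F "\<lambda>g \<omega>. srw (g v) (stl \<omega>) k" _ _ shd]
    by blast
  then show ?case
    by (simp only: srw_Suc_shift)
qed simp

lemma card_PiE_component:
  assumes "finite V" and "v \<in> V" and "u \<in> N v"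
  shows "card {f \<in> Pi\<^sub>E V N. f v = u} * card (N v) = card (Pi\<^sub>E V N)"
proof -
  have "{f \<in> Pi\<^sub>E V N. f v = u} = Pi\<^sub>E V (N(v := {u}))"
    using assms by (auto simp: PiE_iff extensional_def split: if_splits)
  moreover have "(\<Prod>x\<in>V. card ((N(v := {u})) x)) = (\<Prod>x\<in>V - {v}. card (N x))"
    using assms by (subst prod.remove[of V v]) auto
  moreover have "(\<Prod>x\<in>V. card (N x)) = card (N v) * (\<Prod>x\<in>V - {v}. card (N x))"
    using assms by (subst prod.remove[of V v]) auto
  ultimately show ?thesis
    using assms by (simp add: card_PiE)
qed

lemma srw_cylinder:
  assumes fin: "finite V"
    and nb: "\<And>u. u \<in> V \<Longrightarrow> finite (neighbours E u) \<and> neighbours E u \<noteq> {}"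
    and x: "\<And>i. i \<le> k \<Longrightarrow> x i \<in> V"
  shows "emeasure (srw_space V E) {\<omega>\<in>space (srw_space V E). \<forall>i\<le>k. srw (x 0) \<omega> i = x i} =
    (\<Prod>i<k. if x (Suc i) \<in> neighbours E (x i)
            then ennreal (1 / card (neighbours E (x i))) else 0)"
  using x
proof (induction k arbitrary: x)
  define F where "F = (\<Pi>\<^sub>E u\<in>V. neighbours E u)"
  have F: "finite F" "F \<noteq> {}"
    using fin nb by (auto simp: F_def PiE_eq_empty_iff intro!: finite_PiE)
  define M where "M = uniform_count_measure F"
  have S: "srw_space V E = stream_space M"
    by (simp add: srw_space_def F_def M_def)
  interpret M: prob_space M
    unfolding M_def using F by (intro prob_space_uniform_count_measure)
  interpret SM: prob_space "stream_space M"
    by (rule M.prob_space_stream_space)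
  {
    case 0
    show ?case
      using SM.emeasure_space_1 by (simp add: S)
  next
    case (Suc k)
    let ?A = "\<lambda>k x. {\<omega>\<in>space (stream_space M). \<forall>i\<le>k. srw (x 0) \<omega> i = x i}"
    let ?N = "neighbours E (x 0)"
    have meas [measurable]: "(\<lambda>\<omega>. srw v \<omega> i) \<in> measurable (stream_space M) (count_space UNIV)"
      for v i using measurable_srw[of V E v i] fin nb by (simp add: S)
    have A: "?A k x \<in> sets (stream_space M)" for k and x :: "nat \<Rightarrow> 'a"
      by measurable
    have split: "{\<omega>\<in>space (stream_space M). f ## \<omega> \<in> ?A (Suc k) x} =
        (if f (x 0) = x 1 then ?A k (x \<circ> Suc) else {})" if "f \<in> space M" for f
    proof -
      have all: "(\<forall>i\<le>Suc k. P i) \<longleftrightarrow> P 0 \<and> (\<forall>i\<le>k. P (Suc i))" for P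
        by (metis Suc_le_mono le0 not0_implies_Suc)
      have 1: "(\<forall>i\<le>Suc k. srw (x 0) (f ## \<omega>) i = x i) \<longleftrightarrow>
          (\<forall>i\<le>k. srw (f (x 0)) \<omega> i = x (Suc i))" for \<omega>
        unfolding all srw_Suc_shift by simp
      have 2: "\<not> (\<forall>i\<le>k. srw (f (x 0)) \<omega> i = x (Suc i))" if "f (x 0) \<noteq> x 1" for \<omega>
        using that by (auto intro!: exI[of _ 0])
      have 3: "f ## \<omega> \<in> space (stream_space M) \<longleftrightarrow> \<omega> \<in> space (stream_space M)" for \<omega>
        using that by (simp add: space_stream_space streams_Stream)
      show ?thesis
      proof (cases "f (x 0) = x 1")
        case True
        show ?thesis unfolding mem_Collect_eq 1 3 o_apply True by simp
      next
        case False
        show ?thesis unfolding mem_Collect_eq 1 3 using False 2[OF False] by simp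
      qed
    qed
    have x0: "x 0 \<in> V" using Suc.prems by simp
    have G: "{f\<in>F. f (x 0) = x 1} \<in> sets M"
      by (auto simp: M_def sets_uniform_count_measure)
    have step: "emeasure M {f\<in>F. f (x 0) = x 1} =
        (if x 1 \<in> ?N then ennreal (1 / card ?N) else 0)"
    proof (cases "x 1 \<in> ?N")
      case True
      have "card {f\<in>F. f (x 0) = x 1} * card ?N = card F"
        unfolding F_def using card_PiE_component[of V "x 0" "x 1" "neighbours E"] fin x0 True by simp
      then have "real (card {f\<in>F. f (x 0) = x 1}) * real (card ?N) = real (card F)"
        unfolding of_nat_mult[symmetric] by (rule arg_cong)
      moreover have "card F > 0" "card ?N > 0"
        using F nb[OF x0] by (simp_all add: card_gt_0_iff)
      ultimately have "real (card {f\<in>F. f (x 0) = x 1}) / real (card F) = 1 / real (card ?N)"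
        by (simp add: field_simps)
      then show ?thesis
        using True F by (simp add: M_def emeasure_uniform_count_measure)
    next
      case False
      then have "{f\<in>F. f (x 0) = x 1} = {}"
        using PiE_mem[OF _ x0, of _ "neighbours E"] by (fastforce simp: F_def)
      then have "emeasure M {f\<in>F. f (x 0) = x 1} = 0" by (simp only: emeasure_empty)
      then show ?thesis using False by simp
    qed
    have "emeasure (stream_space M) (?A (Suc k) x) =
        (\<integral>\<^sup>+f. emeasure (stream_space M) {\<omega>\<in>space (stream_space M). f ## \<omega> \<in> ?A (Suc k) x} \<partial>M)"
      by (rule M.emeasure_stream_space[OF A])
    also have "\<dots> = (\<integral>\<^sup>+f. emeasure (stream_space M) (?A k (x \<circ> Suc)) *
        indicator {f\<in>F. f (x 0) = x 1} f \<partial>M)"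
      by (intro nn_integral_cong, subst split)
         (auto simp: M_def space_uniform_count_measure split: split_indicator)
    also have "\<dots> = emeasure (stream_space M) (?A k (x \<circ> Suc)) * emeasure M {f\<in>F. f (x 0) = x 1}"
      by (rule nn_integral_cmult_indicator[OF G])
    finally show ?case
      using Suc.IH[of "x \<circ> Suc"] Suc.prems
      unfolding S step o_def by (simp add: prod.lessThan_Suc_shift mult.commute del: prod.lessThan_Suc)
  }
qed

end

theory Submission
  imports Defs
begin

text \<open>
  In a tree of order \<open>n\<close> with distance \<open>d\<close> and \<open>D(v) = \<Sum>w. d v w\<close>, every vertex
  \<open>v \<noteq> z\<close> has exactly one neighbour closer to \<open>z\<close>, all others being farther by one. Hence
  \<open>(n - 1) d v w + D(w) - D(v)\<close> solves the first-step equations for the hitting time of \<open>w\<close>,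
  whose solution is unique by the maximum principle, and summing over \<open>w\<close> gives
  \<open>CC(r) = (\<Sum>v. D(v)) - D(r)\<close>.

  This quantity is bounded by induction on \<open>n\<close>, deleting a vertex \<open>l\<close> farthest from \<open>r\<close>. It drops
  by \<open>2 D(l) - d r l\<close>, and since the eccentricity of \<open>l\<close> is at most \<open>2 d r l\<close> this is at most
  \<open>n\<^sup>2 - n - \<lfloor>n / 2\<rfloor>\<close>, the difference of consecutive values of the claimed maximum.
\<close>

section \<open>Graph distance\<close>

lemma graph_walk_singleton [simp]: "graph_walk V E [x] \<longleftrightarrow> x \<in> V"
  by (simp add: graph_walk_def)

lemma graph_walk_Cons_Cons [simp]:
  "graph_walk V E (x # y # ys) \<longleftrightarrow> x \<in> V \<and> {x, y} \<in> E \<and> graph_walk V E (y # ys)"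
  by (auto simp: graph_walk_def)

lemma graph_walk_Cons:
  "graph_walk V E ys \<Longrightarrow> x \<in> V \<Longrightarrow> {x, hd ys} \<in> E \<Longrightarrow> graph_walk V E (x # ys)"
  by (cases ys) (auto simp: graph_walk_def)

lemma graph_walk_rev: "graph_walk V E xs \<Longrightarrow> graph_walk V E (rev xs)"
  by (simp add: graph_walk_def insert_commute)

lemma graph_walk_append_tl:
  assumes "graph_walk V E xs" "graph_walk V E ys" "last xs = hd ys"
  shows "graph_walk V E (xs @ tl ys)" "hd (xs @ tl ys) = hd xs" "last (xs @ tl ys) = last ys"
    "length (xs @ tl ys) = length xs + length ys - 1"
proof -
  obtain y zs where ys: "ys = y # zs"
    using assms(2) by (cases ys) (auto simp: graph_walk_def)
  show "graph_walk V E (xs @ tl ys)"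
    using assms by (cases zs) (auto simp: ys graph_walk_def successively_append_iff)
  show "hd (xs @ tl ys) = hd xs" "last (xs @ tl ys) = last ys"
    "length (xs @ tl ys) = length xs + length ys - 1"
    using assms by (auto simp: ys graph_walk_def)
qed

text \<open>Cutting out the stretch between two occurrences of a repeated vertex shortens the walk
  and keeps both ends.\<close>

lemma graph_walk_distinct:
  assumes "graph_walk V E xs"
  shows "\<exists>ys. graph_walk V E ys \<and> distinct ys \<and> hd ys = hd xs \<and> last ys = last xs"
  using assms
proof (induction "length xs" arbitrary: xs rule: less_induct)
  case less
  show ?case
  proof (cases "distinct xs")
    case False
    then obtain as b bs cs where xs: "xs = as @ [b] @ bs @ [b] @ cs"
      using not_distinct_decomp by blast
    let ?ys = "as @ [b] @ cs"
    have "graph_walk V E ?ys"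
      using less.prems unfolding graph_walk_def xs
      by (auto simp: successively_append_iff successively_Cons)
    moreover have "length ?ys < length xs" "hd ?ys = hd xs" "last ?ys = last xs"
      by (auto simp: xs hd_append)
    ultimately show ?thesis
      using less.hyps[of ?ys] by auto
  qed (use less.prems in blast)
qed

lemma graph_dist_le:
  assumes "graph_walk V E xs"
  shows "graph_dist V E (hd xs) (last xs) \<le> length xs - 1"
  unfolding graph_dist_def
  by (rule Least_le) (use assms in \<open>auto simp: graph_walk_def intro!: exI[of _ xs]\<close>)

locale finite_connected_graph =
  fixes V :: "'a set" and E :: "'a set set"
  assumes simple: "simple_graph V E" and conn: "connected_graph V E"
begin

abbreviation d :: "'a \<Rightarrow> 'a \<Rightarrow> nat" where "d \<equiv> graph_dist V E"

lemma finite_V: "finite V"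
  using simple by (simp add: simple_graph_def)

lemma edgeD: "{u, v} \<in> E \<Longrightarrow> u \<in> V \<and> v \<in> V \<and> u \<noteq> v"
  using simple unfolding simple_graph_def by (metis card_2_iff insert_subset doubleton_eq_iff)

lemma geodesic:
  assumes "u \<in> V" "v \<in> V"
  obtains xs where "graph_walk V E xs" "hd xs = u" "last xs = v" "length xs = Suc (d u v)"
proof -
  obtain ys where ys: "graph_walk V E ys" "hd ys = u" "last ys = v"
    using conn assms unfolding connected_graph_def by blast
  then have "\<exists>k xs. graph_walk V E xs \<and> hd xs = u \<and> last xs = v \<and> length xs = Suc k"
    by (intro exI[of _ "length ys - 1"] exI[of _ ys]) (auto simp: graph_walk_def)
  from LeastI_ex[OF this] that show ?thesis
    unfolding graph_dist_def by blast
qed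

lemma dist_self [simp]: "u \<in> V \<Longrightarrow> d u u = 0"
  using graph_dist_le[of V E "[u]"] by simp

lemma dist_eq_0_iff: "u \<in> V \<Longrightarrow> v \<in> V \<Longrightarrow> d u v = 0 \<longleftrightarrow> u = v"
proof
  assume "u \<in> V" "v \<in> V" "d u v = 0"
  then show "u = v"
    by (metis geodesic length_0_conv length_Suc_conv last_ConsL list.sel(1))
qed simp

lemma dist_commute:
  assumes "u \<in> V" "v \<in> V"
  shows "d u v = d v u"
proof -
  have "d a b \<le> d b a" if ab: "a \<in> V" "b \<in> V" for a b
  proof -
    obtain xs where "graph_walk V E xs" "hd xs = b" "last xs = a" "length xs = Suc (d b a)"
      using geodesic[OF ab(2,1)] .
    then show ?thesis
      using graph_dist_le[OF graph_walk_rev, of V E xs] by (simp add: hd_rev last_rev)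
  qed
  with assms show ?thesis
    by (meson le_antisym)
qed

lemma dist_triangle:
  assumes "u \<in> V" "v \<in> V" "w \<in> V"
  shows "d u w \<le> d u v + d v w"
proof -
  obtain xs where xs: "graph_walk V E xs" "hd xs = u" "last xs = v" "length xs = Suc (d u v)"
    using geodesic assms by metis
  obtain ys where ys: "graph_walk V E ys" "hd ys = v" "last ys = w" "length ys = Suc (d v w)"
    using geodesic assms by metis
  show ?thesis
    using graph_dist_le[of V E "xs @ tl ys"] graph_walk_append_tl[OF xs(1) ys(1)] xs ys by simp
qed

lemma dist_eq_1_iff:
  assumes "u \<in> V" "v \<in> V"
  shows "d u v = 1 \<longleftrightarrow> {u, v} \<in> E"
proof
  assume "d u v = 1"
  then obtain xs where xs: "graph_walk V E xs" "hd xs = u" "last xs = v" "length xs = Suc (Suc 0)"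
    using geodesic[OF assms] by (metis One_nat_def)
  then obtain a b where "xs = [a, b]"
    by (auto simp: length_Suc_conv)
  with xs show "{u, v} \<in> E" by simp
next
  assume e: "{u, v} \<in> E"
  then have "d u v \<le> 1"
    using graph_dist_le[of V E "[u, v]"] assms by simp
  then show "d u v = 1"
    using dist_eq_0_iff[OF assms] edgeD[OF e] by (cases "d u v") auto
qed

text \<open>Take the second vertex of a geodesic: the rest is a walk to \<open>z\<close> one step
  shorter, and the triangle inequality excludes a larger drop.\<close>

lemma closer_neighbour:
  assumes "v \<in> V" "z \<in> V" "v \<noteq> z"
  shows "\<exists>u. {v, u} \<in> E \<and> d v z = Suc (d u z)"
proof -
  obtain xs where xs: "graph_walk V E xs" "hd xs = v" "last xs = z" "length xs = Suc (d v z)"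
    using geodesic assms by metis
  moreover have "d v z \<noteq> 0"
    using dist_eq_0_iff assms by simp
  ultimately obtain u ys where ys: "xs = v # u # ys"
    by (cases xs; cases "tl xs") auto
  have e: "{v, u} \<in> E" and w: "graph_walk V E (u # ys)"
    using xs ys by auto
  have "d u z \<le> length ys"
    using graph_dist_le[OF w] xs ys by simp
  moreover have "d v z \<le> d v u + d u z" "d v u = 1"
    using dist_triangle[of v u z] dist_eq_1_iff[of v u] edgeD[OF e] e assms by auto
  ultimately have "d v z = Suc (d u z)"
    using xs ys by simp
  with e show ?thesis by blast
qed

text \<open>Descending from \<open>x\<close> through closer neighbours never meets \<open>v\<close>:
  after the first step the distance to \<open>z\<close> is below \<open>d v z\<close>, and
  \<open>x\<close> itself differs from \<open>v\<close>. Two such walks will make up a cycle through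
  \<open>v\<close>.\<close>

lemma walk_avoiding:
  assumes "v \<in> V" "z \<in> V" "z \<noteq> v" "x \<in> V" "x \<noteq> v" "d x z \<le> d v z"
  shows "\<exists>xs. graph_walk (V - {v}) E xs \<and> hd xs = x \<and> last xs = z"
  using assms(4-6)
proof (induction "d x z" arbitrary: x rule: less_induct)
  case less
  show ?case
  proof (cases "x = z")
    case True
    then show ?thesis
      using assms by (intro exI[of _ "[z]"]) simp
  next
    case False
    then obtain y where y: "{x, y} \<in> E" "d x z = Suc (d y z)"
      using closer_neighbour less.prems assms by blast
    then obtain ys where ys: "graph_walk (V - {v}) E ys" "hd ys = y" "last ys = z"
      using less.hyps[of y] less.prems edgeD[OF y(1)] by fastforce
    have "ys \<noteq> []" using ys by (simp add: graph_walk_def)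
    then show ?thesis
      using graph_walk_Cons[OF ys(1), of x] ys y less.prems by (intro exI[of _ "x # ys"]) auto
  qed
qed

end

section \<open>Tree metrics\<close>

text \<open>The edges are forgotten: adjacency is distance one, and acyclicity survives only as the
  last axiom, a unique neighbour towards each target. Vertices can then be deleted in the induction
  while \<open>d\<close> stays the same function.\<close>

locale tree_metric =
  fixes V :: "'a set" and d :: "'a \<Rightarrow> 'a \<Rightarrow> nat"
  assumes finite_V: "finite V"
    and dist_eq_0_iff: "\<And>u v. u \<in> V \<Longrightarrow> v \<in> V \<Longrightarrow> d u v = 0 \<longleftrightarrow> u = v"
    and dist_commute: "\<And>u v. u \<in> V \<Longrightarrow> v \<in> V \<Longrightarrow> d u v = d v u"
    and dist_triangle: "\<And>u v w. u \<in> V \<Longrightarrow> v \<in> V \<Longrightarrow> w \<in> V \<Longrightarrow> d u w \<le> d u v + d v w"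
    and ex_parent: "\<And>v z. v \<in> V \<Longrightarrow> z \<in> V \<Longrightarrow> v \<noteq> z \<Longrightarrow>
      \<exists>p\<in>V. d v p = 1 \<and> d v z = Suc (d p z) \<and>
        (\<forall>u\<in>V. d v u = 1 \<longrightarrow> u \<noteq> p \<longrightarrow> d u z = Suc (d v z))"

lemma tree_graph_connected: "tree_graph V E \<Longrightarrow> finite_connected_graph V E"
  by (simp add: tree_graph_def finite_connected_graph_def)

lemma tree_graph_metric:
  assumes "tree_graph V E"
  shows "tree_metric V (graph_dist V E)"
proof -
  interpret finite_connected_graph V E
    using assms by (rule tree_graph_connected)
  \<comment> \<open>Two distinct such neighbours would be joined through \<open>z\<close> by a walk
    avoiding \<open>v\<close>; made distinct and closed up by \<open>v\<close>, it is a
    cycle.\<close>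
  have unique: "a = b" if v: "{v, a} \<in> E" "{v, b} \<in> E" and z: "z \<in> V" "z \<noteq> v"
    and le: "d a z \<le> d v z" "d b z \<le> d v z" for v a b z
  proof (rule ccontr)
    assume "a \<noteq> b"
    have V: "v \<in> V" "a \<in> V" "a \<noteq> v" "b \<in> V" "b \<noteq> v"
      using edgeD[OF v(1)] edgeD[OF v(2)] by auto
    obtain xs where xs: "graph_walk (V - {v}) E xs" "hd xs = a" "last xs = z"
      using walk_avoiding[of v z a] V z le by auto
    obtain ys where ys: "graph_walk (V - {v}) E ys" "hd ys = b" "last ys = z"
      using walk_avoiding[of v z b] V z le by auto
    have "ys \<noteq> []" using ys by (simp add: graph_walk_def)
    then have "last xs = hd (rev ys)" "last (rev ys) = b"
      using xs ys by (simp_all add: hd_rev last_rev)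
    with graph_walk_append_tl[OF xs(1) graph_walk_rev[OF ys(1)]] xs(2)
    obtain zs where "graph_walk (V - {v}) E zs" "hd zs = a" "last zs = b"
      by metis
    then obtain zs where zs: "graph_walk (V - {v}) E zs" "distinct zs" "hd zs = a" "last zs = b"
      using graph_walk_distinct by metis
    have ne: "zs \<noteq> []" "set zs \<subseteq> V - {v}" using zs by (auto simp: graph_walk_def)
    have "graph_walk V E zs"
      using zs(1) by (auto simp: graph_walk_def)
    then have "graph_walk V E (v # zs)"
      using graph_walk_Cons zs V v by metis
    moreover have "distinct (v # zs)"
      using zs ne by auto
    moreover have "3 \<le> length (v # zs)"
      using ne zs \<open>a \<noteq> b\<close> by (cases zs; cases "tl zs") auto
    moreover have "{last (v # zs), hd (v # zs)} \<in> E"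
      using ne zs v by (simp add: insert_commute)
    ultimately have "graph_cycle V E (v # zs)"
      unfolding graph_cycle_def by blast
    then show False
      using assms by (auto simp: tree_graph_def)
  qed
  show ?thesis
  proof
    fix v z assume vz: "v \<in> V" "z \<in> V" "v \<noteq> z"
    obtain p where p: "{v, p} \<in> E" "d v z = Suc (d p z)"
      using closer_neighbour[OF vz] by blast
    have "d u z = Suc (d v z)" if u: "u \<in> V" "d v u = 1" "u \<noteq> p" for u
    proof -
      have e: "{v, u} \<in> E"
        using dist_eq_1_iff u vz by blast
      have "\<not> d u z \<le> d v z"
        using unique[OF e p(1), of z] vz p u by auto
      moreover have "d u z \<le> d u v + d v z" "d u v = 1"
        using dist_triangle[of u v z] dist_commute[of u v] u vz by auto
      ultimately show ?thesis by simp
    qed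
    moreover have "p \<in> V" "d v p = 1"
      using p edgeD[OF p(1)] dist_eq_1_iff by auto
    ultimately show "\<exists>p\<in>V. d v p = 1 \<and> d v z = Suc (d p z) \<and>
        (\<forall>u\<in>V. d v u = 1 \<longrightarrow> u \<noteq> p \<longrightarrow> d u z = Suc (d v z))"
      using p by blast
  qed (fact finite_V dist_eq_0_iff dist_commute dist_triangle)+
qed

section \<open>Neighbour sums and the first-step equation\<close>

context tree_metric
begin

abbreviation total_dist :: "'a \<Rightarrow> nat" where
  "total_dist v \<equiv> \<Sum>w\<in>V. d v w"

text \<open>Away from the target, counting every neighbour as one step farther errs by 2, at the
  parent only; at the target all neighbours have distance 1.\<close>

lemma sum_neighbours_dist:
  assumes "v \<in> V" "z \<in> V"
  shows "(\<Sum>u\<in>{u\<in>V. d v u = 1}. int (d u z)) =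
    (if v = z then int (card {u\<in>V. d v u = 1})
     else int (card {u\<in>V. d v u = 1}) * (int (d v z) + 1) - 2)"
proof (cases "v = z")
  case True
  have "(\<Sum>u\<in>{u\<in>V. d v u = 1}. int (d u z)) = (\<Sum>u\<in>{u\<in>V. d v u = 1}. 1)"
    using True assms by (intro sum.cong) (auto simp: dist_commute)
  then show ?thesis using True by simp
next
  case False
  let ?N = "{u\<in>V. d v u = 1}"
  obtain p where p: "p \<in> V" "d v p = 1" "d v z = Suc (d p z)"
      "\<forall>u\<in>V. d v u = 1 \<longrightarrow> u \<noteq> p \<longrightarrow> d u z = Suc (d v z)"
    using ex_parent[OF assms False] by blast
  have fin: "finite ?N" using finite_V by simp
  have "(\<Sum>u\<in>?N. int (d u z)) = (\<Sum>u\<in>?N. (int (d v z) + 1) - (if u = p then 2 else 0))"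
    using p by (intro sum.cong) auto
  also have "\<dots> = int (card ?N) * (int (d v z) + 1) - 2"
    using p fin by (simp add: sum_subtractf)
  finally show ?thesis using False by simp
qed

lemma sum_neighbours_total_dist:
  assumes "v \<in> V"
  defines "N \<equiv> {u\<in>V. d v u = 1}"
  shows "(\<Sum>u\<in>N. int (total_dist u)) =
    int (card N) * int (total_dist v) + (int (card V) - 1) * (int (card N) - 2) + int (card N)"
proof -
  have "(\<Sum>u\<in>N. int (total_dist u)) = (\<Sum>z\<in>V. \<Sum>u\<in>N. int (d u z))"
    by (simp add: sum.swap[of _ V])
  \<comment> \<open>The formula for \<open>z \<noteq> v\<close> would give \<open>card N - 2\<close>
    at \<open>z = v\<close>, where the true value is \<open>card N\<close>; hence the extra
    2.\<close>
  also have "\<dots> = (\<Sum>z\<in>V. int (card N) * int (d v z) + (int (card N) - 2) + (if z = v then 2 else 0))"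
    using assms sum_neighbours_dist[OF assms(1)] dist_eq_0_iff
    by (intro sum.cong) (auto simp: algebra_simps)
  also have "\<dots> = int (card N) * int (total_dist v) + int (card V) * (int (card N) - 2) + 2"
    using assms finite_V by (simp add: sum.distrib sum_distrib_left)
  finally show ?thesis
    by (simp add: algebra_simps)
qed

text \<open>The closed form of the hitting time of \<open>w\<close> from \<open>v\<close>.\<close>

definition hit :: "'a \<Rightarrow> 'a \<Rightarrow> int" where
  "hit w v = (int (card V) - 1) * int (d v w) + int (total_dist w) - int (total_dist v)"

lemma hit_self: "w \<in> V \<Longrightarrow> hit w w = 0"
  using dist_eq_0_iff by (simp add: hit_def)

text \<open>\<open>hit w v\<close> is the sum over \<open>z\<close> of the triangle defects
  \<open>?f z\<close>, minus \<open>d v w\<close>. All defects are nonnegative, and the one at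
  \<open>z = v\<close> alone is \<open>2 * d v w\<close>.\<close>

lemma hit_nonneg:
  assumes "v \<in> V" "w \<in> V"
  shows "0 \<le> hit w v"
proof -
  let ?f = "\<lambda>z. int (d v w) + int (d w z) - int (d v z)"
  have nn: "0 \<le> ?f z" if "z \<in> V" for z
    using dist_triangle[of v w z] assms that by linarith
  have "int (d v w) \<le> ?f v"
    using assms dist_eq_0_iff[of v v] dist_commute[of v w] by simp
  also have "?f v \<le> (\<Sum>z\<in>V. ?f z)"
    using nn assms finite_V by (intro member_le_sum) auto
  also have "\<dots> = int (card V) * int (d v w) + int (total_dist w) - int (total_dist v)"
    by (simp add: sum.distrib sum_subtractf)
  finally show ?thesis
    by (simp add: hit_def algebra_simps)
qed

text \<open>This is the first-step equation, multiplied by the degree to stay in the integers. Both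
  neighbour sums contribute \<open>(card V - 1) * (card N - 2)\<close>, which cancels and leaves
  \<open>- card N\<close>.\<close>

lemma sum_neighbours_hit:
  assumes "v \<in> V" "w \<in> V" "v \<noteq> w"
  defines "N \<equiv> {u\<in>V. d v u = 1}"
  shows "(\<Sum>u\<in>N. hit w u) = int (card N) * (hit w v - 1)"
proof -
  have "(\<Sum>u\<in>N. hit w u) = (int (card V) - 1) * (\<Sum>u\<in>N. int (d u w)) +
      int (card N) * int (total_dist w) - (\<Sum>u\<in>N. int (total_dist u))"
    by (simp add: hit_def sum.distrib sum_subtractf sum_distrib_left)
  also have "\<dots> = int (card N) * (hit w v - 1)"
    unfolding N_def sum_neighbours_dist[OF assms(1,2)] sum_neighbours_total_dist[OF assms(1)] hit_def
    using assms(3) by (simp add: algebra_simps)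
  finally show ?thesis .
qed

text \<open>\<open>total_dist r\<close> enters \<open>card V - 1\<close> times through the distances
  and is subtracted \<open>card V\<close> times.\<close>

lemma sum_hit:
  "(\<Sum>w\<in>V. hit w r) = (\<Sum>v\<in>V. int (total_dist v)) - int (total_dist r)"
  by (simp add: hit_def sum.distrib sum_subtractf sum_distrib_left[symmetric] algebra_simps)

end

section \<open>The extremal bound\<close>

context tree_metric
begin

text \<open>Following parents from \<open>z\<close> towards \<open>v\<close> lowers the distance by
  one at a time, so no value is skipped.\<close>

lemma ex_at_dist:
  assumes "v \<in> V" "z \<in> V" "j \<le> d v z"
  shows "\<exists>u\<in>V. d v u = j"
  using assms(2,3)
proof (induction "d v z" arbitrary: z)
  case 0
  then show ?case by auto
next
  case (Suc k)
  show ?case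
  proof (cases "j = d v z")
    case False
    have "z \<noteq> v" using Suc dist_eq_0_iff assms(1) by (metis nat.distinct(1))
    then obtain p where "p \<in> V" "d z v = Suc (d p v)"
      using ex_parent Suc.prems assms(1) by blast
    then show ?thesis
      using Suc False dist_commute assms(1) by (metis Suc_inject le_SucE)
  qed (use Suc.prems in blast)
qed

text \<open>With \<open>e\<close> the eccentricity of \<open>v\<close>, each distance from 0 to
  \<open>e\<close> is taken by some vertex; the other \<open>card V - 1 - e\<close> vertices
  contribute at most \<open>e\<close> each. Everything is doubled to avoid halving
  \<open>e * (e + 1)\<close>.\<close>

lemma total_dist_le:
  assumes v: "v \<in> V" and z: "z \<in> V" and far: "\<And>u. u \<in> V \<Longrightarrow> d v u \<le> d v z"
  shows "d v z < card V" "2 * total_dist v \<le> d v z * (2 * card V - 1 - d v z)"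
proof -
  define e where "e = d v z"
  obtain g where g: "\<And>j. j \<le> e \<Longrightarrow> g j \<in> V \<and> d v (g j) = j"
    using ex_at_dist[OF v z] unfolding e_def by metis
  have inj: "inj_on g {..e}"
    using g by (metis atMost_iff inj_onI)
  have sub: "g ` {..e} \<subseteq> V"
    using g by auto
  have card: "card (g ` {..e}) = Suc e"
    using inj by (simp add: card_image)
  then have less: "e < card V"
    using card_mono[OF finite_V sub] by simp
  then show "d v z < card V"
    by (simp add: e_def)
  have "total_dist v = (\<Sum>u\<in>V - g ` {..e}. d v u) + (\<Sum>u\<in>g ` {..e}. d v u)"
    using sub finite_V by (rule sum.subset_diff)
  also have "(\<Sum>u\<in>g ` {..e}. d v u) = (\<Sum>j\<le>e. j)"
    using g by (simp add: sum.reindex[OF inj])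
  also have "(\<Sum>u\<in>V - g ` {..e}. d v u) \<le> card (V - g ` {..e}) * e"
    using far sum_bounded_above[of "V - g ` {..e}" "d v" e] by (simp add: e_def)
  also have "card (V - g ` {..e}) = card V - Suc e"
    using card finite_subset[OF sub finite_V] by (simp add: card_Diff_subset sub)
  finally have "2 * total_dist v \<le> 2 * ((card V - Suc e) * e) + 2 * (\<Sum>j\<le>e. j)"
    by simp
  also have "2 * (\<Sum>j\<le>e. j) = e * (e + 1)"
    by (induction e) auto
  also have "2 * ((card V - Suc e) * e) + e * (e + 1) = e * (2 * card V - 1 - e)"
  proof -
    obtain k where "card V = Suc e + k"
      using less by (metis Suc_leI le_Suc_ex)
    then show ?thesis by (simp add: algebra_simps)
  qed
  finally show "2 * total_dist v \<le> d v z * (2 * card V - 1 - d v z)"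
    by (simp add: e_def)
qed

text \<open>A neighbour of \<open>l\<close> other than its parent would be farther from
  \<open>r\<close> than \<open>l\<close>, so \<open>l\<close> is a leaf. It remains to see that a
  leaf is never the parent of another vertex towards a third one.\<close>

lemma farthest_leaf:
  assumes l: "l \<in> V" "l \<noteq> r" and r: "r \<in> V" and far: "\<And>u. u \<in> V \<Longrightarrow> d r u \<le> d r l"
  shows "tree_metric (V - {l}) d"
proof -
  obtain p where p: "p \<in> V" "d l p = 1"
      "\<forall>u\<in>V. d l u = 1 \<longrightarrow> u \<noteq> p \<longrightarrow> d u r = Suc (d l r)"
    using ex_parent[OF l(1) r l(2)] by blast
  have only: "u = p" if "u \<in> V" "d l u = 1" for u
    using p that far[of u] dist_commute[of u r] dist_commute[of l r] l r
    by (metis Suc_n_not_le_n)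
  show ?thesis
  proof
    fix v z assume vz: "v \<in> V - {l}" "z \<in> V - {l}" "v \<noteq> z"
    obtain q where q: "q \<in> V" "d v q = 1" "d v z = Suc (d q z)"
        "\<forall>u\<in>V. d v u = 1 \<longrightarrow> u \<noteq> q \<longrightarrow> d u z = Suc (d v z)"
      using ex_parent[of v z] vz by blast
    \<comment> \<open>If \<open>l\<close> were the parent of \<open>v\<close>, then
      \<open>v\<close>, as the only neighbour of \<open>l\<close>, would be the parent of
      \<open>l\<close> towards \<open>z\<close>, and each would be nearer to \<open>z\<close> than
      the other.\<close>
    have "q \<noteq> l"
    proof
      assume "q = l"
      then have "d l v = 1"
        using q vz l dist_commute by (metis DiffD1)
      moreover obtain q' where "q' \<in> V" "d l q' = 1" "d l z = Suc (d q' z)"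
        using ex_parent[of l z] vz l by blast
      ultimately show False
        using only[of v] only[of q'] vz q \<open>q = l\<close> by auto
    qed
    then show "\<exists>p\<in>V - {l}. d v p = 1 \<and> d v z = Suc (d p z) \<and>
        (\<forall>u\<in>V - {l}. d v u = 1 \<longrightarrow> u \<noteq> p \<longrightarrow> d u z = Suc (d v z))"
      using q by blast
  qed (use finite_V dist_eq_0_iff dist_commute dist_triangle in auto)
qed

text \<open>The deficit \<open>k\<close> of the eccentricity of \<open>l\<close> below its maximal value \<open>card V - 1\<close> lowers the
  bound on \<open>2 * total_dist l\<close> by \<open>k + k\<^sup>2\<close>, while it lowers that on \<open>d r l\<close> only by about \<open>k / 2\<close>.\<close>

lemma total_dist_farthest_le:
  assumes l: "l \<in> V" and r: "r \<in> V" and far: "\<And>u. u \<in> V \<Longrightarrow> d r u \<le> d r l"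
  shows "2 * total_dist l + card V div 2 + card V \<le> d r l + card V * card V"
proof -
  have "Max (d l ` V) \<in> d l ` V"
    using l finite_V by (intro Max_in) auto
  then obtain z where z: "z \<in> V" "d l z = Max (d l ` V)"
    by auto
  have far_z: "d l u \<le> d l z" if "u \<in> V" for u
    using z that finite_V by simp
  obtain k where k: "card V = Suc (d l z) + k"
    using total_dist_le(1)[OF l z(1) far_z] by (metis Suc_leI le_Suc_ex)
  have "d l z \<le> 2 * d r l"
    using dist_triangle[of l r z] far[OF z(1)] dist_commute[of l r] l r z by simp
  \<comment> \<open>Here \<open>card V \<le> 2 * d r l + k + 1\<close> and
    \<open>(k + 1) div 2 \<le> k\<close>. The next bound supplies the matching \<open>k\<close>,
    since \<open>(n - 1 - k) * (n + k) = n^2 - n - k - k^2\<close> for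
    \<open>n = card V\<close>.\<close>
  then have "card V div 2 \<le> d r l + k"
    using k by simp
  moreover have "2 * total_dist l + k + card V \<le> card V * card V"
    using total_dist_le(2)[OF l z(1) far_z] k by (simp add: algebra_simps)
  ultimately show ?thesis by simp
qed

end

text \<open>The claimed bound on the sum of all \<open>D(v)\<close> less \<open>D(r)\<close>,
  cleared of the denominator 3 and arranged so that no subtraction of naturals occurs.\<close>

lemma sum_dist_bound:
  assumes "tree_metric V d" "r \<in> V"
  shows "3 * (\<Sum>v\<in>V. \<Sum>w\<in>V. d v w) + 3 * ((card V)\<^sup>2 div 4) + card V
    \<le> 3 * (\<Sum>w\<in>V. d r w) + card V ^ 3"
  using assms
proof (induction "card V" arbitrary: V)
  case 0
  then show ?case
    using tree_metric.finite_V by fastforce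
next
  case (Suc m)
  interpret tree_metric V d by fact
  show ?case
  proof (cases "V = {r}")
    case True
    then show ?thesis
      using dist_eq_0_iff[of r r] by simp
  next
    case False
    have "Max (d r ` V) \<in> d r ` V"
      using Suc finite_V by (intro Max_in) auto
    then obtain l where l: "l \<in> V" "d r l = Max (d r ` V)"
      by auto
    have far: "d r u \<le> d r l" if "u \<in> V" for u
      using l that finite_V by simp
    have "l \<noteq> r"
    proof
      assume "l = r"
      then have "u = r" if "u \<in> V" for u
        using far[OF that] dist_eq_0_iff[of r r] dist_eq_0_iff[of r u] that Suc.prems by simp
      with False Suc.prems show False by blast
    qed
    let ?V = "V - {l}"
    have cm: "card ?V = m"
      using Suc l by simp
    have IH: "3 * (\<Sum>v\<in>?V. \<Sum>w\<in>?V. d v w) + 3 * (m\<^sup>2 div 4) + m \<le> 3 * (\<Sum>w\<in>?V. d r w) + m ^ 3"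
      using Suc.hyps(1)[of ?V] farthest_leaf[OF l(1) \<open>l \<noteq> r\<close> Suc.prems(2) far] \<open>l \<noteq> r\<close> Suc.prems cm
      by simp
    have rem: "(\<Sum>w\<in>V. f w) = f l + (\<Sum>w\<in>?V. f w)" for f :: "'a \<Rightarrow> nat"
      using finite_V l by (simp add: sum.remove)
    have "(\<Sum>v\<in>?V. d v l) = (\<Sum>v\<in>?V. d l v)"
      using l dist_commute by (intro sum.cong) auto
    \<comment> \<open>Deleting \<open>l\<close> removes a row and a column of the distance matrix,
      equal by symmetry and meeting in a zero.\<close>
    then have W: "(\<Sum>v\<in>V. \<Sum>w\<in>V. d v w) = 2 * total_dist l + (\<Sum>v\<in>?V. \<Sum>w\<in>?V. d v w)"
      using dist_eq_0_iff[of l l] l by (simp add: rem sum.distrib)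
    have sq: "(Suc m)\<^sup>2 div 4 = m\<^sup>2 div 4 + Suc m div 2"
    proof (cases "even m")
      case True
      then obtain j where "m = 2 * j" by blast
      then show ?thesis by (simp add: power2_eq_square algebra_simps)
    next
      case False
      then obtain j where "m = 2 * j + 1" by (auto elim: oddE)
      then show ?thesis by (simp add: power2_eq_square algebra_simps)
    qed
    have "2 * total_dist l + Suc m div 2 + Suc m \<le> d r l + Suc m * Suc m"
      using total_dist_farthest_le[OF l(1) Suc.prems(2) far] Suc.hyps(2) by simp
    moreover have "(\<Sum>w\<in>V. d r w) = d r l + (\<Sum>w\<in>?V. d r w)"
      by (rule rem)
    moreover have "Suc m ^ 3 + 3 * Suc m = m ^ 3 + 3 * (Suc m * Suc m) + 1"
      by (simp add: power3_eq_cube algebra_simps)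
    \<comment> \<open>The induction step with powers, products and quotients replaced by variables,
      so that only linear arithmetic is left: \<open>s\<close> stands for
      \<open>Suc m * Suc m\<close>, \<open>q\<close> for \<open>m\<^sup>2 div 4\<close>,
      \<open>h\<close> for \<open>Suc m div 2\<close>, \<open>c\<close> and \<open>c'\<close> for
      the cubes.\<close>
    moreover have "3 * (2 * D + W) + 3 * (q + h) + Suc m \<le> 3 * R + c'"
      if "2 * D + h + Suc m \<le> e + s" "R = e + R'" "c' + 3 * Suc m = c + 3 * s + 1"
        "3 * W + 3 * q + m \<le> 3 * R' + c" for D W q h R R' c c' e s :: nat
      using that by simp
    ultimately show ?thesis
      using IH unfolding W Suc.hyps(2)[symmetric] sq by blast
  qed
qed

section \<open>Hitting times\<close>

text \<open>In the definition the index set depends on the trajectory. Moving the dependence into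
  the values gives a countable infimum that is measurable term by term and can be reindexed.\<close>

lemma first_hit_eq_INF: "first_hit w X = (INF k. if X k = w then of_nat k else \<infinity>)"
  unfolding first_hit_def
proof (rule antisym)
  show "(INF k\<in>{k. X k = w}. of_nat k) \<le> (INF k. if X k = w then of_nat k else \<infinity> :: ennreal)"
    by (intro INF_greatest) (auto intro: INF_lower)
  show "(INF k. if X k = w then of_nat k else \<infinity> :: ennreal) \<le> (INF k\<in>{k. X k = w}. of_nat k)"
  proof (rule INF_greatest)
    fix k assume "k \<in> {k. X k = w}"
    then show "(INF k. if X k = w then of_nat k else \<infinity> :: ennreal) \<le> of_nat k"
      by (intro INF_lower2[of k]) auto
  qed
qed

lemma first_hit_start: "X 0 = w \<Longrightarrow> first_hit w X = 0"
  unfolding first_hit_def by (metis (mono_tags) INF_lower le_zero_eq mem_Collect_eq of_nat_0)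

lemma first_hit_Suc:
  assumes "X 0 \<noteq> w"
  shows "first_hit w X = 1 + first_hit w (\<lambda>k. X (Suc k))"
proof -
  define f :: "nat \<Rightarrow> ennreal" where "f k = (if X k = w then of_nat k else \<infinity>)" for k
  have "(INF k. f (Suc k)) \<le> f k" for k
    using assms INF_lower[of _ UNIV "\<lambda>k. f (Suc k)"] by (cases k) (auto simp: f_def[of 0])
  then have "(INF k. f k) = (INF k. f (Suc k))"
    by (intro antisym INF_greatest) (auto intro: INF_lower)
  also have "\<dots> = (INF k. 1 + (if X (Suc k) = w then of_nat k else \<infinity>))"
    by (intro INF_cong) (auto simp: f_def)
  finally show ?thesis
    unfolding first_hit_eq_INF f_def by (simp only: INF_ennreal_const_add)
qed

section \<open>Random walk on a finite graph without isolated vertices\<close>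

locale srw_graph =
  fixes V :: "'a set" and E :: "'a set set"
  assumes finite_V: "finite V"
    and nb_subset: "\<And>u. u \<in> V \<Longrightarrow> neighbours E u \<subseteq> V"
    and nb_nonempty: "\<And>u. u \<in> V \<Longrightarrow> neighbours E u \<noteq> {}"
begin

abbreviation "F \<equiv> \<Pi>\<^sub>E u\<in>V. neighbours E u"
abbreviation "M \<equiv> uniform_count_measure F"

lemma finite_nb: "u \<in> V \<Longrightarrow> finite (neighbours E u)"
  using finite_V nb_subset finite_subset by blast

lemma finite_F: "finite F" and F_nonempty: "F \<noteq> {}"
  using finite_V finite_nb nb_nonempty by (auto simp: PiE_eq_empty_iff intro!: finite_PiE)

lemma prob_space_M: "prob_space M"
  using finite_F F_nonempty by (rule prob_space_uniform_count_measure)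

lemma measurable_first_hit [measurable]:
  "(\<lambda>\<omega>. first_hit w (srw v \<omega>)) \<in> borel_measurable (srw_space V E)"
proof -
  note [measurable] = measurable_srw[OF finite_V finite_nb]
  show ?thesis
    unfolding first_hit_eq_INF by measurable
qed

text \<open>The value at \<open>v\<close> of a uniformly random map in \<open>F\<close> is a
  uniformly random neighbour, because the fibres of evaluation at \<open>v\<close> all have the same
  size.\<close>

lemma nn_integral_step:
  assumes "v \<in> V"
  shows "(\<integral>\<^sup>+f. g (f v) \<partial>M) = (\<Sum>u\<in>neighbours E v. ennreal (1 / card (neighbours E v)) * g u)"
proof -
  let ?N = "neighbours E v" and ?A = "\<lambda>u. {f\<in>F. f v = u}"
  have A: "?A u \<in> sets M" for u
    by (auto simp: sets_uniform_count_measure)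
  have em: "emeasure M (?A u) = ennreal (1 / card ?N)" if "u \<in> ?N" for u
  proof -
    have "card (?A u) * card ?N = card F"
      using card_PiE_component[of V v u "neighbours E"] finite_V assms that by simp
    then have "real (card (?A u)) * real (card ?N) = real (card F)"
      unfolding of_nat_mult[symmetric] by (rule arg_cong)
    moreover have "card F > 0" "card ?N > 0"
      using finite_F F_nonempty finite_nb nb_nonempty assms by (simp_all add: card_gt_0_iff)
    ultimately have "real (card (?A u)) / real (card F) = 1 / real (card ?N)"
      by (simp add: field_simps)
    then show ?thesis
      using finite_F by (simp add: emeasure_uniform_count_measure)
  qed
  have "(\<integral>\<^sup>+f. g (f v) \<partial>M) = (\<integral>\<^sup>+f. (\<Sum>u\<in>?N. g u * indicator (?A u) f) \<partial>M)"
  proof (rule nn_integral_cong)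
    fix f assume "f \<in> space M"
    then have f: "f \<in> F" "f v \<in> ?N"
      using assms by (auto simp: space_uniform_count_measure)
    have "(\<Sum>u\<in>?N. g u * indicator (?A u) f) = (\<Sum>u\<in>?N. if u = f v then g u else 0)"
      using f by (intro sum.cong) (auto split: split_indicator)
    then show "g (f v) = (\<Sum>u\<in>?N. g u * indicator (?A u) f)"
      using f finite_nb[OF assms] by simp
  qed
  also have "\<dots> = (\<Sum>u\<in>?N. \<integral>\<^sup>+f. g u * indicator (?A u) f \<partial>M)"
    by (rule nn_integral_sum) (use A in measurable)
  also have "\<dots> = (\<Sum>u\<in>?N. g u * ennreal (1 / card ?N))"
    using A em by (intro sum.cong) (auto simp: nn_integral_cmult_indicator)
  finally show ?thesis
    by (simp add: mult.commute)
qed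

text \<open>Condition on the head of the stream, which is independent of the tail. The general
  \<open>f\<close> and \<open>g\<close> serve both the hitting time and its truncations.\<close>

lemma nn_integral_first_step:
  assumes "v \<in> V" and f: "f \<in> borel_measurable (srw_space V E)"
    and g: "\<And>u. g u \<in> borel_measurable (srw_space V E)"
    and shift: "\<And>\<omega>. f \<omega> = 1 + g (shd \<omega> v) (stl \<omega>)"
  shows "(\<integral>\<^sup>+\<omega>. f \<omega> \<partial>srw_space V E) =
    1 + (\<Sum>u\<in>neighbours E v. ennreal (1 / card (neighbours E v)) *
           (\<integral>\<^sup>+\<omega>. g u \<omega> \<partial>srw_space V E))"
proof -
  interpret M: prob_space M by (rule prob_space_M)
  interpret S: prob_space "stream_space M" by (rule M.prob_space_stream_space)
  have meas: "k \<in> borel_measurable M" for k :: "('a \<Rightarrow> 'a) \<Rightarrow> ennreal"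
    by (auto simp: measurable_def sets_uniform_count_measure space_uniform_count_measure)
  have "(\<integral>\<^sup>+\<omega>. f \<omega> \<partial>stream_space M) =
      (\<integral>\<^sup>+h. \<integral>\<^sup>+\<omega>. f (h ## \<omega>) \<partial>stream_space M \<partial>M)"
    using f by (intro M.nn_integral_stream_space) (simp add: srw_space_def)
  also have "\<dots> = (\<integral>\<^sup>+h. 1 + (\<integral>\<^sup>+\<omega>. g (h v) \<omega> \<partial>stream_space M) \<partial>M)"
    using g by (simp add: shift nn_integral_add srw_space_def S.emeasure_space_1)
  also have "\<dots> = 1 + (\<integral>\<^sup>+h. (\<integral>\<^sup>+\<omega>. g (h v) \<omega> \<partial>stream_space M) \<partial>M)"
    by (subst nn_integral_add[OF meas meas]) (simp only: nn_integral_const M.emeasure_space_1 mult_1)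
  finally show ?thesis
    using nn_integral_step[OF assms(1), of "\<lambda>u. \<integral>\<^sup>+\<omega>. g u \<omega> \<partial>stream_space M"]
    by (simp add: srw_space_def)
qed

lemma hitting_time_self: "hitting_time V E w w = 0"
  by (simp add: hitting_time_def first_hit_start)

lemma srw_shift: "v \<noteq> w \<Longrightarrow>
    first_hit w (srw v \<omega>) = 1 + first_hit w (srw (shd \<omega> v) (stl \<omega>))"
  by (subst first_hit_Suc) (simp_all only: srw.simps(1) srw_Suc_shift, simp)

lemma hitting_time_step:
  assumes "v \<in> V" "v \<noteq> w"
  shows "hitting_time V E v w =
    1 + (\<Sum>u\<in>neighbours E v. ennreal (1 / card (neighbours E v)) * hitting_time V E u w)"
  unfolding hitting_time_def
  using assms by (intro nn_integral_first_step measurable_first_hit srw_shift)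

text \<open>The hitting time truncated at \<open>k\<close> is bounded by \<open>h\<close> by
  induction on \<open>k\<close>, and monotone convergence removes the truncation. No finiteness has
  to be known beforehand; it comes out as a consequence.\<close>

lemma hitting_time_le:
  fixes h :: "'a \<Rightarrow> real"
  assumes h0: "h w = 0" and nonneg: "\<And>v. v \<in> V \<Longrightarrow> 0 \<le> h v"
    and harm: "\<And>v. v \<in> V \<Longrightarrow> v \<noteq> w \<Longrightarrow>
      (\<Sum>u\<in>neighbours E v. h u) = card (neighbours E v) * (h v - 1)"
    and v: "v \<in> V"
  shows "hitting_time V E v w \<le> ennreal (h v)"
proof -
  let ?T = "\<lambda>k v \<omega>. min (first_hit w (srw v \<omega>)) (of_nat k)"
  have trunc: "(\<integral>\<^sup>+\<omega>. ?T k v \<omega> \<partial>srw_space V E) \<le> ennreal (h v)" if "v \<in> V" for k v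
    using that
  proof (induction k arbitrary: v)
    case (Suc k)
    show ?case
    proof (cases "v = w")
      case True
      then show ?thesis by (simp add: first_hit_start)
    next
      case False
      let ?N = "neighbours E v" and ?c = "1 / real (card (neighbours E v))"
      have N: "card ?N > 0"
        using finite_nb nb_nonempty Suc.prems by (simp add: card_gt_0_iff)
      have h_nb: "0 \<le> h u" if "u \<in> ?N" for u
        using nonneg nb_subset Suc.prems that by blast
      have "(\<integral>\<^sup>+\<omega>. ?T (Suc k) v \<omega> \<partial>srw_space V E) =
          1 + (\<Sum>u\<in>?N. ennreal ?c * (\<integral>\<^sup>+\<omega>. ?T k u \<omega> \<partial>srw_space V E))"
      proof (rule nn_integral_first_step[OF Suc.prems])
        show "?T (Suc k) v \<in> borel_measurable (srw_space V E)"
          "?T k u \<in> borel_measurable (srw_space V E)" for u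
          by (intro borel_measurable_min measurable_first_hit borel_measurable_const)+
        \<comment> \<open>The first step uses up one unit of the truncation level.\<close>
        show "?T (Suc k) v \<omega> = 1 + ?T k (shd \<omega> v) (stl \<omega>)" for \<omega>
          using False by (simp add: srw_shift min_def)
      qed
      also have "\<dots> \<le> 1 + (\<Sum>u\<in>?N. ennreal ?c * ennreal (h u))"
        using nb_subset[OF Suc.prems]
        by (intro add_left_mono sum_mono mult_left_mono Suc.IH) auto
      also have "\<dots> = 1 + ennreal (\<Sum>u\<in>?N. ?c * h u)"
        using h_nb by (simp add: ennreal_mult[symmetric])
      also have "\<dots> = ennreal (1 + (\<Sum>u\<in>?N. ?c * h u))"
        using h_nb by (subst ennreal_plus) (auto intro!: sum_nonneg)
      also have "(\<Sum>u\<in>?N. ?c * h u) = h v - 1"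
        using harm[OF Suc.prems False] N by (simp add: sum_divide_distrib[symmetric])
      finally show ?thesis by simp
    qed
  qed simp
  have "(\<lambda>k. ?T k v \<omega>) \<longlonglongrightarrow> first_hit w (srw v \<omega>)" for \<omega>
  proof -
    have "(\<lambda>k. ?T k v \<omega>) \<longlonglongrightarrow> min (first_hit w (srw v \<omega>)) \<infinity>"
      by (intro tendsto_min tendsto_const) (simp add: of_nat_tendsto_top_ennreal)
    then show ?thesis by simp
  qed
  moreover have inc: "incseq (\<lambda>k. ?T k v \<omega>)" for \<omega>
    by (intro incseq_SucI min.mono) auto
  ultimately have SUP: "(SUP k. ?T k v \<omega>) = first_hit w (srw v \<omega>)" for \<omega>
    using LIMSEQ_unique LIMSEQ_SUP by blast
  have "incseq (\<lambda>k. ?T k v)"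
    using inc by (simp add: mono_def le_fun_def)
  moreover have "?T k v \<in> borel_measurable (srw_space V E)" for k
    by (intro borel_measurable_min measurable_first_hit borel_measurable_const)
  ultimately have "(\<integral>\<^sup>+\<omega>. (SUP k. ?T k v \<omega>) \<partial>srw_space V E) =
      (SUP k. \<integral>\<^sup>+\<omega>. ?T k v \<omega> \<partial>srw_space V E)"
    by (rule nn_integral_monotone_convergence_SUP)
  then have "hitting_time V E v w = (SUP k. \<integral>\<^sup>+\<omega>. ?T k v \<omega> \<partial>srw_space V E)"
    unfolding hitting_time_def SUP .
  also have "\<dots> \<le> ennreal (h v)"
    using trunc[OF v] by (intro SUP_least)
  finally show ?thesis .
qed

text \<open>The difference of two solutions of the first-step equations is harmonic off \<open>w\<close>; among its
  maximizers the one of least \<open>rank\<close> must be \<open>w\<close>, where the difference vanishes.\<close>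

lemma hitting_time_eq:
  fixes h :: "'a \<Rightarrow> real" and rank :: "'a \<Rightarrow> nat"
  assumes w: "w \<in> V" and h0: "h w = 0" and nonneg: "\<And>v. v \<in> V \<Longrightarrow> 0 \<le> h v"
    and harm: "\<And>v. v \<in> V \<Longrightarrow> v \<noteq> w \<Longrightarrow>
      (\<Sum>u\<in>neighbours E v. h u) = card (neighbours E v) * (h v - 1)"
    and rank: "\<And>v. v \<in> V \<Longrightarrow> v \<noteq> w \<Longrightarrow> \<exists>u\<in>neighbours E v. rank u < rank v"
    and v: "v \<in> V"
  shows "hitting_time V E v w = ennreal (h v)"
proof -
  \<comment> \<open>Passing to reals loses nothing on \<open>V\<close>, as the upper bound just
    proved makes the hitting times finite.\<close>
  define H where "H v = enn2real (hitting_time V E v w)" for v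
  have H: "hitting_time V E v w = ennreal (H v)" if "v \<in> V" for v
    using hitting_time_le[OF h0 nonneg harm that] unfolding H_def
    by (intro ennreal_enn2real[symmetric]) (simp add: order_le_less_trans)
  have H_nonneg: "0 \<le> H v" for v
    by (simp add: H_def)
  have H_step: "(\<Sum>u\<in>neighbours E v. H u) = card (neighbours E v) * (H v - 1)"
    if v: "v \<in> V" "v \<noteq> w" for v
  proof -
    let ?N = "neighbours E v" and ?c = "1 / real (card (neighbours E v))"
    have N: "card ?N > 0"
      using finite_nb nb_nonempty v by (simp add: card_gt_0_iff)
    have "ennreal (H v) = 1 + (\<Sum>u\<in>?N. ennreal ?c * hitting_time V E u w)"
      using hitting_time_step[OF v] H v by simp
    also have "\<dots> = 1 + (\<Sum>u\<in>?N. ennreal (?c * H u))"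
      using H nb_subset[OF v(1)] H_nonneg
      by (intro arg_cong[of _ _ "(+) 1"] sum.cong) (auto simp: ennreal_mult[symmetric])
    also have "\<dots> = 1 + ennreal (\<Sum>u\<in>?N. ?c * H u)"
      using H_nonneg by (subst sum_ennreal) auto
    also have "\<dots> = ennreal (1 + (\<Sum>u\<in>?N. ?c * H u))"
      using H_nonneg by (subst ennreal_plus) (auto intro!: sum_nonneg)
    finally have "H v = 1 + (\<Sum>u\<in>?N. ?c * H u)"
      using H_nonneg by (subst (asm) ennreal_inj) (auto intro!: sum_nonneg add_nonneg_nonneg)
    then show ?thesis
      using N by (simp add: sum_divide_distrib[symmetric] field_simps)
  qed
  define D where "D v = h v - H v" for v
  have D_le: "D u \<le> Max (D ` V)" if "u \<in> V" for u
    using that finite_V by simp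
  have "Max (D ` V) \<in> D ` V"
    using finite_V w by (intro Max_in) auto
  then have "\<exists>x. x \<in> V \<and> D x = Max (D ` V)"
    by auto
  then obtain x where x: "x \<in> V" "D x = Max (D ` V)"
    and least: "\<And>y. y \<in> V \<and> D y = Max (D ` V) \<Longrightarrow> rank x \<le> rank y"
    using ex_has_least_nat[of "\<lambda>x. x \<in> V \<and> D x = Max (D ` V)" _ rank] by metis
  have "x = w"
  proof (rule ccontr)
    assume "x \<noteq> w"
    then obtain u where u: "u \<in> neighbours E x" "rank u < rank x"
      using rank x by blast
    let ?N = "neighbours E x"
    \<comment> \<open>By the first-step equations these differences sum to 0; none is negative at a
      maximizer, so every neighbour of \<open>x\<close> is a maximizer too, including
      \<open>u\<close> of smaller rank.\<close>
    have "(\<Sum>y\<in>?N. D x - D y) = card ?N * (h x - H x) - ((\<Sum>y\<in>?N. h y) - (\<Sum>y\<in>?N. H y))"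
      by (simp add: D_def sum_subtractf)
    also have "\<dots> = 0"
      unfolding harm[OF x(1) \<open>x \<noteq> w\<close>] H_step[OF x(1) \<open>x \<noteq> w\<close>] by (simp add: algebra_simps)
    finally have "(\<Sum>y\<in>?N. D x - D y) = 0" .
    moreover have "\<And>y. y \<in> ?N \<Longrightarrow> 0 \<le> D x - D y"
      using D_le x nb_subset[OF x(1)] by auto
    ultimately have "D x - D u = 0"
      using sum_nonneg_eq_0_iff[OF finite_nb[OF x(1)], of "\<lambda>y. D x - D y"] u by blast
    then have "rank x \<le> rank u"
      using least[of u] x u nb_subset[OF x(1)] by auto
    with u show False by simp
  qed
  moreover have "D w = 0"
    by (simp add: D_def H_def h0 hitting_time_self)
  \<comment> \<open>The maximum of \<open>D\<close> is its value at \<open>w\<close>. The opposite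
    inequality is \<open>hitting_time_le\<close>, so minimizers need no separate argument.\<close>
  ultimately have "D v \<le> 0"
    using D_le[OF v] x by simp
  then have "ennreal (h v) \<le> hitting_time V E v w"
    using H[OF v] by (simp add: D_def ennreal_leI)
  with hitting_time_le[OF h0 nonneg harm v] show ?thesis
    by simp
qed

end

text \<open>\<open>hit w\<close> satisfies the hypotheses of \<open>hitting_time_eq\<close> with the
  distance to \<open>w\<close> as rank, and \<open>sum_hit\<close> adds up the values.\<close>

lemma cover_cost_tree:
  assumes tree: "tree_graph V E" and "card V \<ge> 2" and r: "r \<in> V"
  shows "cover_cost V E r = ennreal (real (\<Sum>v\<in>V. \<Sum>w\<in>V. graph_dist V E v w) -
    real (\<Sum>w\<in>V. graph_dist V E r w))"
proof -
  interpret G: finite_connected_graph V E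
    using tree by (rule tree_graph_connected)
  interpret T: tree_metric V "graph_dist V E"
    using tree by (rule tree_graph_metric)
  have nb: "neighbours E v = {u\<in>V. graph_dist V E v u = 1}" if "v \<in> V" for v
    using G.dist_eq_1_iff that G.edgeD by (auto simp: neighbours_def)
  interpret srw_graph V E
  proof
    fix v assume v: "v \<in> V"
    show "neighbours E v \<subseteq> V"
      using nb[OF v] by auto
    \<comment> \<open>A second vertex exists, and a geodesic to it starts with a neighbour of
      \<open>v\<close>.\<close>
    have "V \<noteq> {v}"
      using assms(2) by auto
    then obtain z where "z \<in> V" "v \<noteq> z"
      using v by blast
    then show "neighbours E v \<noteq> {}"
      using G.closer_neighbour[of v z] v by (auto simp: neighbours_def)
  qed (fact G.finite_V)
  have "hitting_time V E r w = ennreal (real_of_int (T.hit w r))" if w: "w \<in> V" for w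
  proof (rule hitting_time_eq[where rank = "\<lambda>v. graph_dist V E v w"])
    fix v assume v: "v \<in> V" "v \<noteq> w"
    have "(\<Sum>u\<in>neighbours E v. T.hit w u) = int (card (neighbours E v)) * (T.hit w v - 1)"
      using T.sum_neighbours_hit[OF v(1) w v(2)] nb[OF v(1)] by simp
    then have "real_of_int (\<Sum>u\<in>neighbours E v. T.hit w u) =
        real_of_int (int (card (neighbours E v)) * (T.hit w v - 1))"
      by (rule arg_cong)
    then show "(\<Sum>u\<in>neighbours E v. real_of_int (T.hit w u)) =
        real (card (neighbours E v)) * (real_of_int (T.hit w v) - 1)"
      by simp
    show "\<exists>u\<in>neighbours E v. graph_dist V E u w < graph_dist V E v w"
      using G.closer_neighbour[OF v(1) w v(2)] by (auto simp: neighbours_def)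
  qed (use w r T.hit_self T.hit_nonneg in auto)
  then have "cover_cost V E r = (\<Sum>w\<in>V. ennreal (real_of_int (T.hit w r)))"
    by (simp add: cover_cost_def)
  also have "\<dots> = ennreal (real_of_int (\<Sum>w\<in>V. T.hit w r))"
    using T.hit_nonneg r by (subst sum_ennreal) auto
  finally show ?thesis
    by (simp add: T.sum_hit)
qed

section \<open>Paths\<close>

text \<open>A turn would return to the value two steps earlier, against injectivity, so the
  direction \<open>s\<close> of the first step persists. Applied to indices along a cycle, this
  shows that a path has no cycles.\<close>

lemma unit_steps_injective_monotone:
  fixes f :: "nat \<Rightarrow> int"
  assumes step: "\<And>i. Suc i < L \<Longrightarrow> \<bar>f (Suc i) - f i\<bar> = 1" and inj: "inj_on f {..<L}" and "k < L"
  shows "\<bar>f k - f 0\<bar> = int k"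
proof (cases "1 < L")
  case True
  define s where "s = f 1 - f 0"
  have s: "\<bar>s\<bar> = 1"
    using step[of 0] True by (simp add: s_def)
  have "f k = f 0 + s * int k" if "k < L" for k
    using that
  proof (induction k rule: less_induct)
    case (less k)
    consider "k = 0" | "k = 1" | j where "k = Suc (Suc j)"
      by (metis One_nat_def not0_implies_Suc)
    then show ?case
    proof cases
      case 3
      have "f j = f 0 + s * int j" "f (Suc j) = f 0 + s * int (Suc j)"
        using less.IH[of j] less.IH[of "Suc j"] less.prems unfolding 3 by simp_all
      moreover have "f k \<noteq> f j"
        using inj_onD[OF inj, of k j] less.prems unfolding 3 by auto
      moreover have "\<bar>f k - f (Suc j)\<bar> = 1"
        using step[of "Suc j"] less.prems 3 by simp
      moreover have "s = 1 \<or> s = - 1"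
        using s by linarith
      ultimately show ?thesis
        unfolding 3 by auto
    qed (auto simp: s_def)
  qed
  from this[OF \<open>k < L\<close>] show ?thesis
    using s by (simp add: abs_mult)
next
  case False
  with \<open>k < L\<close> have "k = 0" by simp
  then show ?thesis by simp
qed

locale list_path =
  fixes xs :: "'a list" and V E
  assumes nonempty: "xs \<noteq> []" and dist_xs: "distinct xs" and V_eq: "V = set xs"
    and E_eq: "E = {{xs ! i, xs ! Suc i} | i. Suc i < length xs}"
begin

abbreviation "n \<equiv> length xs"

lemma bij: "bij_betw ((!) xs) {..<n} V"
  using bij_betw_nth[OF dist_xs] V_eq by simp

lemma card_V: "card V = n"
  using dist_xs V_eq distinct_card by simp

lemma edge_iff:
  assumes "i < n" "j < n"
  shows "{xs ! i, xs ! j} \<in> E \<longleftrightarrow> \<bar>int i - int j\<bar> = 1"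
proof -
  have eq: "xs ! a = xs ! b \<longleftrightarrow> a = b" if "a < n" "b < n" for a b
    using dist_xs that nth_eq_iff_index_eq by blast
  have "{xs ! i, xs ! j} \<in> E \<longleftrightarrow> (\<exists>k. Suc k < n \<and> {xs ! i, xs ! j} = {xs ! k, xs ! Suc k})"
    by (auto simp: E_eq)
  also have "\<dots> \<longleftrightarrow> (\<exists>k. Suc k < n \<and> (i = k \<and> j = Suc k \<or> i = Suc k \<and> j = k))"
    using assms eq by (auto simp: doubleton_eq_iff)
  also have "\<dots> \<longleftrightarrow> j = Suc i \<or> i = Suc j"
    using assms by auto
  also have "\<dots> \<longleftrightarrow> \<bar>int i - int j\<bar> = 1"
    by auto
  finally show ?thesis .
qed

lemma segment_walk:
  assumes "i \<le> j" "j < n"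
  shows "graph_walk V E (map ((!) xs) [i..<Suc j])"
    "hd (map ((!) xs) [i..<Suc j]) = xs ! i" "last (map ((!) xs) [i..<Suc j]) = xs ! j"
proof -
  show "hd (map ((!) xs) [i..<Suc j]) = xs ! i" "last (map ((!) xs) [i..<Suc j]) = xs ! j"
    using assms by (simp_all add: hd_map del: upt_Suc) (simp_all add: last_map)
  have "successively (\<lambda>u v. {u, v} \<in> E) (map ((!) xs) [i..<Suc j])"
    using assms edge_iff unfolding successively_conv_nth by (auto simp del: upt_Suc)
  then show "graph_walk V E (map ((!) xs) [i..<Suc j])"
    using assms by (auto simp: graph_walk_def V_eq)
qed

lemma simple: "simple_graph V E"
  unfolding simple_graph_def
proof (intro conjI ballI)
  fix e assume "e \<in> E"
  then obtain i where i: "Suc i < n" "e = {xs ! i, xs ! Suc i}"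
    by (auto simp: E_eq)
  then have "xs ! i \<noteq> xs ! Suc i"
    using dist_xs by (simp add: nth_eq_iff_index_eq)
  with i show "e \<subseteq> V" "card e = 2"
    by (auto simp: V_eq)
qed (simp add: V_eq)

lemma connected: "connected_graph V E"
  unfolding connected_graph_def
proof (intro conjI ballI)
  fix u v assume "u \<in> V" "v \<in> V"
  then obtain i j where ij: "i < n" "u = xs ! i" "j < n" "v = xs ! j"
    by (auto simp: V_eq in_set_conv_nth)
  show "\<exists>ys. graph_walk V E ys \<and> hd ys = u \<and> last ys = v"
  proof (cases "i \<le> j")
    case True
    then show ?thesis using segment_walk[of i j] ij by blast
  next
    case False
    let ?ys = "map ((!) xs) [j..<Suc i]"
    have "graph_walk V E (rev ?ys)" "hd (rev ?ys) = u" "last (rev ?ys) = v"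
      using segment_walk[of j i] False ij by (simp_all only: graph_walk_rev hd_rev last_rev)
    then show ?thesis by blast
  qed
qed (use nonempty V_eq in auto)

sublocale finite_connected_graph V E
  by standard (fact simple connected)+

definition index :: "'a \<Rightarrow> nat" where
  "index = inv_into {..<n} ((!) xs)"

lemma index_nth: "i < n \<Longrightarrow> index (xs ! i) = i"
  using bij by (simp add: index_def bij_betw_inv_into_left)

lemma nth_index: "v \<in> V \<Longrightarrow> xs ! index v = v" "v \<in> V \<Longrightarrow> index v < n"
  using bij bij_betw_inv_into_right[OF bij] bij_betwE[OF bij_betw_inv_into[OF bij]]
  by (auto simp: index_def)

lemma edge_index: "{u, v} \<in> E \<Longrightarrow> \<bar>int (index u) - int (index v)\<bar> = 1"
  using edge_iff[of "index u" "index v"] nth_index edgeD by metis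

text \<open>Each edge changes the index by exactly one; this gives the lower bound for distances in
  a path.\<close>

lemma walk_index_le:
  "graph_walk V E ys \<Longrightarrow> \<bar>int (index (hd ys)) - int (index (last ys))\<bar> \<le> int (length ys) - 1"
proof (induction ys rule: induct_list012)
  case (3 x y zs)
  then show ?case
    using edge_index[of x y] by auto
qed (auto simp: graph_walk_def)

lemma path_dist:
  assumes "i < n" "j < n"
  shows "int (d (xs ! i) (xs ! j)) = \<bar>int i - int j\<bar>"
proof -
  have V: "xs ! i \<in> V" "xs ! j \<in> V"
    using assms by (auto simp: V_eq)
  have le: "int (d (xs ! a) (xs ! b)) \<le> int b - int a" if "a \<le> b" "b < n" for a b
    using graph_dist_le[OF segment_walk(1)[OF that]] segment_walk(2,3)[OF that] that by simp
  have "int (d (xs ! i) (xs ! j)) \<le> \<bar>int i - int j\<bar>"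
    using le[of i j] le[of j i] dist_commute[OF V] assms by (cases "i \<le> j") auto
  moreover obtain ys where "graph_walk V E ys" "hd ys = xs ! i" "last ys = xs ! j"
      "length ys = Suc (d (xs ! i) (xs ! j))"
    using geodesic[OF V] .
  then have "\<bar>int i - int j\<bar> \<le> int (d (xs ! i) (xs ! j))"
    using walk_index_le[of ys] index_nth assms by simp
  ultimately show ?thesis by simp
qed

lemma tree: "tree_graph V E"
  unfolding tree_graph_def
proof (intro conjI notI)
  assume "\<exists>ys. graph_cycle V E ys"
  then obtain ys where ys: "graph_walk V E ys" "distinct ys" "3 \<le> length ys" "{last ys, hd ys} \<in> E"
    by (auto simp: graph_cycle_def)
  let ?f = "\<lambda>k. int (index (ys ! k))"
  \<comment> \<open>The ends of the cycle have indices at least 2 apart, while its closing edge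
    demands a difference of 1.\<close>
  have "\<bar>?f (length ys - 1) - ?f 0\<bar> = int (length ys - 1)"
  proof (rule unit_steps_injective_monotone)
    show "\<bar>?f (Suc i) - ?f i\<bar> = 1" if "Suc i < length ys" for i
      using ys(1) that edge_index[of "ys ! i" "ys ! Suc i"]
      by (simp add: graph_walk_def successively_conv_nth abs_minus_commute)
    have "ys ! k \<in> V" if "k < length ys" for k
      using ys(1) that by (auto simp: graph_walk_def)
    then show "inj_on ?f {..<length ys}"
      using ys(2) nth_index(1) by (intro inj_onI) (metis lessThan_iff nth_eq_iff_index_eq of_nat_eq_iff)
  qed (use ys in auto)
  moreover have "ys \<noteq> []" using ys by auto
  ultimately show False
    using edge_index[OF ys(4)] ys(3) by (simp add: last_conv_nth hd_conv_nth)
qed (fact simple connected)+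

lemma sum_V: "(\<Sum>v\<in>V. f v) = (\<Sum>i<n. f (xs ! i))"
  using sum.reindex_bij_betw[OF bij] by metis

text \<open>Multiplying by 4 completes the square, which shows how far \<open>i\<close> is from the
  centre of the path.\<close>

lemma total_dist_nth:
  assumes "i < n"
  shows "4 * (\<Sum>w\<in>V. int (d (xs ! i) w)) = (int n)\<^sup>2 - 1 + (2 * int i - int n + 1)\<^sup>2"
proof -
  \<comment> \<open>Partial sums have two regimes: up to \<open>m = i\<close> all terms are
    \<open>i - j\<close>, afterwards the terms \<open>j - i\<close> join in. Only
    \<open>m = n\<close> in the second regime is used.\<close>
  have "4 * (\<Sum>j<m. \<bar>int i - int j\<bar>) = (if m \<le> i then 2 * int m * (2 * int i - int m + 1)
      else (int m)\<^sup>2 - 1 + (2 * int i - int m + 1)\<^sup>2)" for m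
    by (induction m) (auto simp: power2_eq_square algebra_simps not_le less_Suc_eq le_Suc_eq)
  then show ?thesis
    using assms path_dist by (simp add: sum_V)
qed

lemma sum_total_dist: "3 * (\<Sum>v\<in>V. \<Sum>w\<in>V. int (d v w)) = int n ^ 3 - int n"
proof -
  \<comment> \<open>The shift \<open>c\<close> is independent of \<open>m\<close> so that induction
    works; it is used with \<open>m = n\<close> and \<open>c = n - 1\<close>.\<close>
  have sq: "3 * (\<Sum>i<m. (2 * int i - c)\<^sup>2) =
      int m * (2 * (int m - 1) * (2 * int m - 1) - 6 * c * (int m - 1) + 3 * c\<^sup>2)" for m c
    by (induction m) (auto simp: power2_eq_square algebra_simps)
  have "12 * (\<Sum>v\<in>V. \<Sum>w\<in>V. int (d v w)) =
      3 * (\<Sum>i<n. 4 * (\<Sum>w\<in>V. int (d (xs ! i) w)))"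
    by (subst sum_V) (simp add: sum_distrib_left)
  also have "\<dots> = 3 * (\<Sum>i<n. (int n)\<^sup>2 - 1 + (2 * int i - (int n - 1))\<^sup>2)"
    by (intro arg_cong[of _ _ "(*) 3"] sum.cong) (simp_all only: lessThan_iff total_dist_nth, simp add: algebra_simps)
  also have "\<dots> = 3 * int n * ((int n)\<^sup>2 - 1) + 3 * (\<Sum>i<n. (2 * int i - (int n - 1))\<^sup>2)"
    by (simp only: sum.distrib sum_constant card_lessThan) (simp add: algebra_simps)
  also have "\<dots> = 4 * (int n ^ 3 - int n)"
    unfolding sq by (simp add: power2_eq_square power3_eq_cube algebra_simps)
  finally show ?thesis by simp
qed

text \<open>Comparison with the central vertex \<open>xs ! (n div 2)\<close> gives
  \<open>4 * ?D \<le> n\<^sup>2\<close>, and dropping the square in \<open>total_dist_nth\<close>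
  gives \<open>n\<^sup>2 \<le> 4 * ?D + 1\<close>. Together they fix the quotient.\<close>

lemma midpoint_total_dist:
  assumes "midpoint_of V E r"
  shows "(\<Sum>w\<in>V. d r w) = n\<^sup>2 div 4"
proof -
  have r: "r \<in> V" and le: "\<And>v. v \<in> V \<Longrightarrow> (\<Sum>w\<in>V. d r w) \<le> (\<Sum>w\<in>V. d v w)"
    using assms by (auto simp: midpoint_of_def)
  let ?D = "\<Sum>w\<in>V. d r w"
  have n: "n div 2 < n"
    using nonempty by simp
  have "xs ! (n div 2) \<in> V"
    using n by (simp add: V_eq)
  then have "int ?D \<le> int (\<Sum>w\<in>V. d (xs ! (n div 2)) w)"
    by (intro of_nat_mono le)
  then have "4 * int ?D \<le> (int n)\<^sup>2 - 1 + (2 * int (n div 2) - int n + 1)\<^sup>2"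
    using total_dist_nth[OF n] by simp
  \<comment> \<open>The base of this square is 1 for even \<open>n\<close> and 0 for odd
    \<open>n\<close>.\<close>
  also have "(2 * int (n div 2) - int n + 1)\<^sup>2 \<le> 1"
    by (cases "even n") (auto elim!: evenE oddE)
  finally have upper: "4 * int ?D \<le> (int n)\<^sup>2"
    by simp
  have "4 * int ?D = (int n)\<^sup>2 - 1 + (2 * int (index r) - int n + 1)\<^sup>2"
    using total_dist_nth[of "index r"] nth_index[OF r] by simp
  then have lower: "(int n)\<^sup>2 \<le> 4 * int ?D + 1"
    by simp
  have "4 * ?D \<le> n\<^sup>2" "n\<^sup>2 \<le> 4 * ?D + 1"
    using upper lower by (simp_all flip: of_nat_power of_nat_le_iff[where 'a = int])
  then show ?thesis by simp
qed

end

section \<open>The maximum and its attainment\<close>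

lemma path_graph_list_path: "path_graph V E \<longleftrightarrow> (\<exists>xs. list_path xs V E)"
  by (auto simp: path_graph_def list_path_def)

lemma path_graph_tree: "path_graph V E \<Longrightarrow> tree_graph V E"
  using list_path.tree by (auto simp: path_graph_list_path)

lemma ex_midpoint:
  assumes "finite V" "V \<noteq> {}"
  shows "\<exists>r. midpoint_of V E r"
proof -
  obtain r where "is_arg_min (\<lambda>v. \<Sum>w\<in>V. graph_dist V E v w) (\<lambda>v. v \<in> V) r"
    using ex_is_arg_min_if_finite[OF assms] by blast
  then show ?thesis
    by (auto simp: midpoint_of_def is_arg_min_linorder)
qed

lemma floor_square_div_4: "\<lfloor>real n ^ 2 / 4\<rfloor> = int (n\<^sup>2 div 4)"
  using floor_divide_of_nat_eq[of "n\<^sup>2" 4, where 'a = real] by simp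

lemma cover_cost_tree_le:
  assumes "tree_graph V E" "card V \<ge> 2" "r \<in> V"
  shows "cover_cost V E r \<le>
    ennreal ((real (card V) ^ 3 - real (card V)) / 3 - real_of_int \<lfloor>real (card V) ^ 2 / 4\<rfloor>)"
proof -
  have "real (3 * (\<Sum>v\<in>V. \<Sum>w\<in>V. graph_dist V E v w) + 3 * ((card V)\<^sup>2 div 4) + card V)
      \<le> real (3 * (\<Sum>w\<in>V. graph_dist V E r w) + card V ^ 3)"
    using sum_dist_bound[OF tree_graph_metric[OF assms(1)] assms(3)] by (rule of_nat_mono)
  then show ?thesis
    unfolding cover_cost_tree[OF assms] floor_square_div_4
    by (intro ennreal_leI) (simp add: field_simps del: of_nat_sum)
qed

lemma cover_cost_path_midpoint:
  assumes "path_graph V E" "card V \<ge> 2" "midpoint_of V E r"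
  shows "cover_cost V E r =
    ennreal ((real (card V) ^ 3 - real (card V)) / 3 - real_of_int \<lfloor>real (card V) ^ 2 / 4\<rfloor>)"
proof -
  obtain xs where "list_path xs V E"
    using assms(1) by (auto simp: path_graph_list_path)
  then interpret list_path xs V E .
  have r: "r \<in> V"
    using assms(3) by (simp add: midpoint_of_def)
  have "real_of_int (3 * (\<Sum>v\<in>V. \<Sum>w\<in>V. int (d v w))) = real_of_int (int n ^ 3 - int n)"
    using sum_total_dist by (rule arg_cong)
  then have "real (\<Sum>v\<in>V. \<Sum>w\<in>V. d v w) = (real n ^ 3 - real n) / 3"
    by simp
  then show ?thesis
    unfolding cover_cost_tree[OF tree assms(2) r] floor_square_div_4 midpoint_total_dist[OF assms(3)]
      card_V by (simp only: of_int_of_nat_eq)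
qed

theorem theorem14:
  fixes n :: nat
  assumes "n \<ge> 2"
  shows "let m = ennreal ((real n ^ 3 - real n) / 3 - real_of_int \<lfloor>real n ^ 2 / 4\<rfloor>) in
    (\<forall>(V :: 'a set) E r. tree_graph V E \<and> card V = n \<and> r \<in> V \<longrightarrow> cover_cost V E r \<le> m) \<and>
    (\<forall>(V :: 'a set) E r. path_graph V E \<and> card V = n \<and> midpoint_of V E r \<longrightarrow>
       cover_cost V E r = m) \<and>
    (\<exists>(V :: nat set) E r. tree_graph V E \<and> card V = n \<and> r \<in> V \<and>
       path_graph V E \<and> midpoint_of V E r \<and> cover_cost V E r = m)"
  unfolding Let_def
proof (intro conjI allI impI)
  fix V :: "'a set" and E r
  assume "tree_graph V E \<and> card V = n \<and> r \<in> V"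
  then show "cover_cost V E r \<le>
      ennreal ((real n ^ 3 - real n) / 3 - real_of_int \<lfloor>real n ^ 2 / 4\<rfloor>)"
    using cover_cost_tree_le[of V E r] assms by auto
next
  fix V :: "'a set" and E r
  assume "path_graph V E \<and> card V = n \<and> midpoint_of V E r"
  then show "cover_cost V E r =
      ennreal ((real n ^ 3 - real n) / 3 - real_of_int \<lfloor>real n ^ 2 / 4\<rfloor>)"
    using cover_cost_path_midpoint[of V E r] assms by auto
next
  \<comment> \<open>The witness lives in \<open>nat\<close> because the type \<open>'a\<close> may
    have fewer than \<open>n\<close> elements.\<close>
  let ?V = "{..<n}" and ?xs = "[0..<n]"
  let ?E = "{{?xs ! i, ?xs ! Suc i} | i. Suc i < length ?xs}"
  have path: "path_graph ?V ?E"
    unfolding path_graph_def using assms by (intro exI[of _ ?xs]) auto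
  obtain r where r: "midpoint_of ?V ?E r"
    using ex_midpoint[of ?V ?E] assms by (metis finite_lessThan lessThan_empty_iff not_numeral_le_zero)
  then have "r \<in> ?V"
    by (simp add: midpoint_of_def)
  moreover have "cover_cost ?V ?E r =
      ennreal ((real n ^ 3 - real n) / 3 - real_of_int \<lfloor>real n ^ 2 / 4\<rfloor>)"
    using cover_cost_path_midpoint[OF path _ r] assms by simp
  ultimately show "\<exists>(V :: nat set) E r. tree_graph V E \<and> card V = n \<and> r \<in> V \<and>
       path_graph V E \<and> midpoint_of V E r \<and> cover_cost V E r =
      ennreal ((real n ^ 3 - real n) / 3 - real_of_int \<lfloor>real n ^ 2 / 4\<rfloor>)"
    using path r path_graph_tree[OF path] card_lessThan[of n] by blast
qed

end
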